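(* Let $C$ be a nonempty closed convex subset of a real Hilbert space $H$ and $T$ a Lipschitz pseudo-contraction from $C$ into itself with Lipschitz constant $L\ge1$ and $F(T)\neq\emptyset$. Assume $\{\tau_n\}_{n\ge0}\subset[\tau,1]$ with $\tau\in(0,1]$, $\{\alpha_n\}_{n\ge0}\subset[a,b]$ with $a,b\in(0,\frac1{L+1})$, and $\{\beta_n\}_{n\ge0}\subset(0,1)$ with $\beta_n\le\alpha_n$ for all $n$. Let $x_0\in C$ be arbitrary and let $\{x_n\}$ be generated, for $n\ge0$, by $$v_n=(1-\alpha_n)x_n+\alpha_nTx_n,\qquad y_n=(1-\beta_n)x_n+\beta_nTv_n,$$ $$C_n'=\{z\in C:\tau_n\alpha_n[1-(1+L)\alpha_n]\|x_n-Tx_n\|^2\le\langle x_n-z,v_n-Tv_n\rangle\},$$ $$C_n''=\{z\in C:\|y_n-z\|^2\le\|x_n-z\|^2-\alpha_n\beta_n(1-2\alpha_n-L^2\alpha_n^2)\|x_n-Tx_n\|^2\},$$ $$C_n=C_n'\cap C_n'',$$ $$Q_n=\{z\in C:\langle z-x_n,x_n-x_0\rangle\ge0\},$$ $$x_{n+1}=P_{C_n^*\cap Q_n}x_0,$$ where $C_n^*$ is a closed convex set with $F(T)\subset C_n^*\subset C_n$. Then $\{x_n\}$ converges strongly to $P_{F(T)}x_0$.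
   Context: $F(T)=\{x\in C:Tx=x\}$. $T$ is a pseudo-contraction if $\|Tx-Ty\|^2\le\|x-y\|^2+\|(I-T)x-(I-T)y\|^2$ for all $x,y\in C$ ($I$ the identity). $T$ is Lipschitz with constant $L$ if $\|Tx-Ty\|\le L\|x-y\|$ for all $x,y\in C$. For a nonempty closed convex set $D\subset H$, $P_D$ is the metric projection (nearest-point map) onto $D$. *)

theory Defs
  imports "HOL-Analysis.Analysis"
begin

definition fixed_points :: "'a set \<Rightarrow> ('a \<Rightarrow> 'a) \<Rightarrow> 'a set" where
  "fixed_points C T = {x \<in> C. T x = x}"

definition pseudo_contraction_on :: "'a::real_inner set \<Rightarrow> ('a \<Rightarrow> 'a) \<Rightarrow> bool" where
  "pseudo_contraction_on C T \<longleftrightarrow>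
     (\<forall>x\<in>C. \<forall>y\<in>C. (norm (T x - T y))\<^sup>2
        \<le> (norm (x - y))\<^sup>2 + (norm ((x - T x) - (y - T y)))\<^sup>2)"

(* The library's closest_point requires heine_borel, hence finite dimension.
   The description below denotes the nearest point when D is a nonempty closed
   convex subset of a Hilbert space; otherwise it may be unspecified. *)
definition metric_proj :: "'a::real_inner set \<Rightarrow> 'a \<Rightarrow> 'a" where
  "metric_proj D x = (THE p. p \<in> D \<and> (\<forall>z\<in>D. dist x p \<le> dist x z))"

end

theory Submission
  imports Defs
begin

text \<open>
  Write \<open>A = I - T\<close>, \<open>F\<close> for the set of fixed points of \<open>T\<close>, and \<open>q\<close> for the projection of
  \<open>x 0\<close> onto \<open>F\<close>. That \<open>T\<close> is a pseudo-contraction means exactly that \<open>A\<close> is monotone, and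
  \<open>F\<close> is the set of zeros of \<open>A\<close>.

  The projections force two facts about the iterates. By induction \<open>F \<subseteq> Q n\<close>, so
  \<open>x (Suc n)\<close> is at least as close to \<open>x 0\<close> as \<open>q\<close> is. The set \<open>Q n\<close> is cut out of \<open>C\<close> by a
  half-space whose nearest point to \<open>x 0\<close> is \<open>x n\<close>, so the squared distance from \<open>x 0\<close>
  increases by at least the square of the step length; as these distances are bounded, the
  steps \<open>x (Suc n) - x n\<close> tend to zero. Membership of \<open>x (Suc n)\<close> in \<open>C' n\<close> bounds
  \<open>norm (A (x n))\<close> by a multiple of the square root of the step length, so \<open>A (x n)\<close> tends to
  zero too.

  It remains to see that a sequence in \<open>C\<close> which is no farther from \<open>x 0\<close> than \<open>q\<close> and on which
  \<open>A\<close> tends to zero must converge to \<open>q\<close> (\<open>converges_to_nearest_fixed_point\<close>). The usual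
  argument takes weak cluster points and uses that \<open>A\<close> is demiclosed. Instead, the iterates are
  compared here with the Browder-Tikhonov path: for \<open>s > 0\<close> the regularized equation
  \<open>A z = s (x 0 - z)\<close> has a solution \<open>z\<^sub>s\<close> in \<open>C\<close>, by the contraction principle
  (\<open>regularized_zero_exists\<close>), and monotonicity makes \<open>z\<^sub>s\<close> converge in norm to \<open>q\<close> as
  \<open>s\<close> decreases to zero (\<open>regularized_path_converges\<close>). Monotonicity between \<open>x n\<close> and
  \<open>z\<^sub>s\<close> gives
  \<open>s \<langle>x n - z\<^sub>s, x 0 - z\<^sub>s\<rangle> \<le> \<langle>x n - z\<^sub>s, A (x n)\<rangle>\<close>, whose right-hand side vanishes as \<open>n\<close>
  grows; thus, in the limit, \<open>x n\<close> lies in the half-space on which \<open>z\<^sub>s\<close> is nearest to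
  \<open>x 0\<close>. Since \<open>x n\<close> is not farther from \<open>x 0\<close> than \<open>q\<close>, and \<open>z\<^sub>s\<close> is almost as far, they must be
  close together.
\<close>

section \<open>Metric projections in a Hilbert space\<close>

text \<open>The triangle with vertices \<open>c\<close>, \<open>p\<close>, \<open>z\<close> has an obtuse angle at \<open>p\<close>. Both the
  variational inequality of a projection and the monotonicity of \<open>I - T\<close> produce such angles.\<close>

lemma obtuse_angle_norm_le:
  fixes c p z :: "'a::real_inner"
  assumes "0 \<le> (z - p) \<bullet> (p - c)"
  shows "(norm (p - c))\<^sup>2 + (norm (z - p))\<^sup>2 \<le> (norm (z - c))\<^sup>2"
proof -
  have "(norm (z - c))\<^sup>2 = (norm (p - c))\<^sup>2 + (norm (z - p))\<^sup>2 + 2 * ((z - p) \<bullet> (p - c))"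
    by (simp add: power2_norm_eq_inner algebra_simps inner_commute)
  with assms show ?thesis by simp
qed

lemma obtuse_angle_norm_mono:
  fixes c p z :: "'a::real_inner"
  assumes "0 \<le> (z - p) \<bullet> (p - c)"
  shows "norm (p - c) \<le> norm (z - c)"
proof (rule power2_le_imp_le)
  show "(norm (p - c))\<^sup>2 \<le> (norm (z - c))\<^sup>2"
    using obtuse_angle_norm_le[OF assms] zero_le_power2[of "norm (z - p)"] by linarith
qed simp

lemma metric_proj_eqI:
  fixes D :: "'a::real_inner set"
  assumes "p \<in> D" and var: "\<And>z. z \<in> D \<Longrightarrow> 0 \<le> (z - p) \<bullet> (p - c)"
  shows "metric_proj D c = p"
  unfolding metric_proj_def
proof (rule the_equality)
  have "dist c p \<le> dist c z" if "z \<in> D" for z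
    using obtuse_angle_norm_mono[OF var[OF that]] by (simp add: dist_norm norm_minus_commute)
  then show "p \<in> D \<and> (\<forall>z\<in>D. dist c p \<le> dist c z)" using assms(1) by blast
next
  fix r assume r: "r \<in> D \<and> (\<forall>z\<in>D. dist c r \<le> dist c z)"
  then have "norm (r - c) \<le> norm (p - c)"
    using assms(1) by (metis dist_commute dist_norm)
  then have "(norm (r - c))\<^sup>2 \<le> (norm (p - c))\<^sup>2" by (simp add: power_mono)
  moreover have "(norm (p - c))\<^sup>2 + (norm (r - p))\<^sup>2 \<le> (norm (r - c))\<^sup>2"
    using r var obtuse_angle_norm_le by blast
  ultimately have "(norm (r - p))\<^sup>2 \<le> 0" by linarith
  then show "r = p" by simp
qed

text \<open>Completeness replaces the local compactness that the analogous facts about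
  \<open>closest_point\<close> rest on: by the parallelogram law, and since the midpoint of two points of
  \<open>D\<close> lies in \<open>D\<close>, every minimizing sequence is Cauchy.\<close>

lemma nearest_point_exists:
  fixes D :: "'a::{real_inner, complete_space} set"
  assumes "closed D" "convex D" "D \<noteq> {}"
  shows "\<exists>p\<in>D. \<forall>z\<in>D. dist c p \<le> dist c z"
proof -
  define S where "S = (\<lambda>z. (norm (z - c))\<^sup>2) ` D"
  define d where "d = Inf S"
  have bdd: "bdd_below S" unfolding S_def by (auto intro!: bdd_belowI[of _ 0])
  have d_le: "d \<le> (norm (z - c))\<^sup>2" if "z \<in> D" for z
    unfolding d_def by (rule cInf_lower[OF _ bdd]) (use that in \<open>auto simp: S_def\<close>)
  have "\<exists>z\<in>D. (norm (z - c))\<^sup>2 < d + inverse (real (Suc k))" for k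
  proof -
    have "\<exists>t\<in>S. t < d + inverse (real (Suc k))"
      unfolding d_def by (rule cInf_lessD) (use assms(3) in \<open>auto simp: S_def\<close>)
    then show ?thesis unfolding S_def by blast
  qed
  then obtain z where zD: "\<And>k. z k \<in> D"
    and zd: "\<And>k. (norm (z k - c))\<^sup>2 < d + inverse (real (Suc k))" by metis
  have par: "(norm (z j - z k))\<^sup>2 \<le> 2 * inverse (real (Suc j)) + 2 * inverse (real (Suc k))" for j k
  proof -
    define m where "m = (1/2) *\<^sub>R z j + (1/2) *\<^sub>R z k"
    have "m \<in> D" unfolding m_def using assms(2) zD by (intro convexD) auto
    then have "d \<le> (norm (m - c))\<^sup>2" by (rule d_le)
    moreover have "(norm (z j - z k))\<^sup>2
        = 2 * (norm (z j - c))\<^sup>2 + 2 * (norm (z k - c))\<^sup>2 - 4 * (norm (m - c))\<^sup>2"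
      unfolding m_def power2_norm_eq_inner by (simp add: algebra_simps inner_commute)
    ultimately show ?thesis using zd[of j] zd[of k] by linarith
  qed
  have "Cauchy z"
  proof (rule metric_CauchyI)
    fix e :: real assume "0 < e"
    then obtain N where N: "inverse (real (Suc N)) < e\<^sup>2 / 4"
      using reals_Archimedean[of "e\<^sup>2/4"] by auto
    have "dist (z j) (z k) < e" if "N \<le> j" "N \<le> k" for j k
    proof -
      have "inverse (real (Suc j)) \<le> inverse (real (Suc N))"
           "inverse (real (Suc k)) \<le> inverse (real (Suc N))"
        using that by (auto intro!: le_imp_inverse_le)
      then have "(norm (z j - z k))\<^sup>2 < e\<^sup>2" using par[of j k] N by linarith
      then show ?thesis unfolding dist_norm
        using \<open>0 < e\<close> by (auto intro: power2_less_imp_less)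
    qed
    then show "\<exists>M. \<forall>m\<ge>M. \<forall>n\<ge>M. dist (z m) (z n) < e" by blast
  qed
  then obtain p where p: "z \<longlonglongrightarrow> p" by (metis Cauchy_convergent convergent_def)
  have "p \<in> D" using assms(1) zD p by (meson closed_sequentially)
  moreover have "dist c p \<le> dist c w" if "w \<in> D" for w
  proof -
    have "(norm (p - c))\<^sup>2 \<le> d + 0"
    proof (rule LIMSEQ_le)
      show "(\<lambda>k. (norm (z k - c))\<^sup>2) \<longlonglongrightarrow> (norm (p - c))\<^sup>2" by (intro tendsto_intros p)
      show "(\<lambda>k. d + inverse (real (Suc k))) \<longlonglongrightarrow> d + 0"
        by (intro tendsto_intros LIMSEQ_inverse_real_of_nat)
    qed (use zd less_imp_le in blast)
    then have "(norm (p - c))\<^sup>2 \<le> (norm (w - c))\<^sup>2" using d_le[OF that] by linarith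
    then show ?thesis
      by (simp add: dist_norm norm_minus_commute abs_le_square_iff[symmetric])
  qed
  ultimately show ?thesis by blast
qed

lemma metric_proj_variational:
  fixes D :: "'a::{real_inner, complete_space} set"
  assumes "closed D" "convex D" "D \<noteq> {}"
  shows "metric_proj D c \<in> D"
    and "\<And>z. z \<in> D \<Longrightarrow> 0 \<le> (z - metric_proj D c) \<bullet> (metric_proj D c - c)"
proof -
  obtain p where p: "p \<in> D" "\<forall>z\<in>D. dist c p \<le> dist c z"
    using nearest_point_exists[OF assms] by blast
  have var: "0 \<le> (z - p) \<bullet> (p - c)" if "z \<in> D" for z
    using any_closest_point_dot[OF assms(2,1) p(1) that p(2)]
    by (simp add: inner_diff algebra_simps inner_commute)
  have "metric_proj D c = p" by (rule metric_proj_eqI[OF p(1) var])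
  then show "metric_proj D c \<in> D"
    and "\<And>z. z \<in> D \<Longrightarrow> 0 \<le> (z - metric_proj D c) \<bullet> (metric_proj D c - c)"
    using p(1) var by auto
qed

section \<open>Sequences of obtuse angles\<close>

lemma obtuse_distances_convergent:
  fixes u :: "nat \<Rightarrow> 'a::real_inner"
  assumes obtuse: "\<And>n. 0 \<le> (u (Suc n) - u n) \<bullet> (u n - c)"
    and bound: "\<And>n. norm (u n - c) \<le> R"
  shows "convergent (\<lambda>n. (norm (u n - c))\<^sup>2)"
proof -
  have "incseq (\<lambda>n. (norm (u n - c))\<^sup>2)"
    using obtuse_angle_norm_mono[OF obtuse] by (intro incseq_SucI power_mono) auto
  moreover have "\<forall>n. (norm (u n - c))\<^sup>2 \<le> R\<^sup>2" using bound by (simp add: power_mono)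
  ultimately obtain l where "(\<lambda>n. (norm (u n - c))\<^sup>2) \<longlonglongrightarrow> l" by (rule incseq_convergent)
  then show ?thesis by (rule convergentI)
qed

text \<open>The obtuse angle inequality bounds the squared length of a step by the increase of the
  squared distance to \<open>c\<close>. If only consecutive points form obtuse angles, this yields vanishing
  steps; if all pairs do, it yields a Cauchy sequence.\<close>

lemma obtuse_steps_tendsto_0:
  fixes u :: "nat \<Rightarrow> 'a::real_inner"
  assumes obtuse: "\<And>n. 0 \<le> (u (Suc n) - u n) \<bullet> (u n - c)"
    and bound: "\<And>n. norm (u n - c) \<le> R"
  shows "(\<lambda>n. norm (u (Suc n) - u n)) \<longlonglongrightarrow> 0"
proof -
  define f where "f n = (norm (u n - c))\<^sup>2" for n
  have step: "f n + (norm (u (Suc n) - u n))\<^sup>2 \<le> f (Suc n)" for n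
    unfolding f_def by (rule obtuse_angle_norm_le[OF obtuse])
  have "convergent f"
    unfolding f_def using obtuse bound by (rule obtuse_distances_convergent)
  then obtain l where l: "f \<longlonglongrightarrow> l" unfolding convergent_def by blast
  have "(\<lambda>n. f (Suc n) - f n) \<longlonglongrightarrow> l - l" by (intro tendsto_diff LIMSEQ_Suc l)
  then have f_diff: "(\<lambda>n. f (Suc n) - f n) \<longlonglongrightarrow> 0" by simp
  have "(\<lambda>n. (norm (u (Suc n) - u n))\<^sup>2) \<longlonglongrightarrow> 0"
  proof (rule tendsto_sandwich[OF _ _ tendsto_const f_diff])
    show "\<forall>\<^sub>F n in sequentially. (norm (u (Suc n) - u n))\<^sup>2 \<le> f (Suc n) - f n"
      by (intro always_eventually allI) (use step in \<open>simp add: le_diff_eq add.commute\<close>)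
  qed simp
  then have "(\<lambda>n. sqrt ((norm (u (Suc n) - u n))\<^sup>2)) \<longlonglongrightarrow> sqrt 0" by (rule tendsto_real_sqrt)
  then show ?thesis by simp
qed

lemma obtuse_sequence_Cauchy:
  fixes u :: "nat \<Rightarrow> 'a::real_inner"
  assumes obtuse: "\<And>m n. m \<le> n \<Longrightarrow> 0 \<le> (u n - u m) \<bullet> (u m - c)"
    and bound: "\<And>n. norm (u n - c) \<le> R"
  shows "Cauchy u"
proof -
  define f where "f n = (norm (u n - c))\<^sup>2" for n
  have "convergent f"
    unfolding f_def using obtuse[OF le_SucI[OF order_refl]] bound
    by (rule obtuse_distances_convergent)
  then have "Cauchy f" by (rule convergent_Cauchy)
  show ?thesis
  proof (rule metric_CauchyI)
    fix e :: real assume e: "0 < e"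
    then obtain N where N: "\<And>m n. m \<ge> N \<Longrightarrow> n \<ge> N \<Longrightarrow> dist (f m) (f n) < e\<^sup>2"
      using metric_CauchyD[OF \<open>Cauchy f\<close>, of "e\<^sup>2"] by auto
    have *: "dist (u m) (u n) < e" if "N \<le> m" "m \<le> n" for m n
    proof -
      have "f n - f m < e\<^sup>2" using N[of m n] that by (simp add: dist_real_def)
      then have "(norm (u n - u m))\<^sup>2 < e\<^sup>2"
        using obtuse_angle_norm_le[OF obtuse[OF that(2)]] by (simp add: f_def)
      then have "norm (u n - u m) < e" using e by (intro power2_less_imp_less[where y = e]) auto
      then show ?thesis by (simp add: dist_norm norm_minus_commute)
    qed
    have "dist (u m) (u n) < e" if "N \<le> m" "N \<le> n" for m n
      using *[of m n] *[of n m] that by (cases "m \<le> n") (auto simp: dist_commute)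
    then show "\<exists>M. \<forall>m\<ge>M. \<forall>n\<ge>M. dist (u m) (u n) < e" by blast
  qed
qed

section \<open>The regularized fixed point equation\<close>

lemma pseudo_contraction_monotone:
  assumes "pseudo_contraction_on C T" "x \<in> C" "y \<in> C"
  shows "0 \<le> ((x - T x) - (y - T y)) \<bullet> (x - y)"
proof -
  define e where "e = (x - T x) - (y - T y)"
  have "(norm (T x - T y))\<^sup>2 \<le> (norm (x - y))\<^sup>2 + (norm e)\<^sup>2"
    using assms unfolding pseudo_contraction_on_def e_def by blast
  moreover have "T x - T y = (x - y) - e" by (simp add: e_def)
  ultimately have "(norm ((x - y) - e))\<^sup>2 \<le> (norm (x - y))\<^sup>2 + (norm e)\<^sup>2" by simp
  moreover have "(norm ((x - y) - e))\<^sup>2 = (norm (x - y))\<^sup>2 + (norm e)\<^sup>2 - 2 * (e \<bullet> (x - y))"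
    unfolding power2_norm_eq_inner
    by (simp add: inner_diff_left inner_diff_right inner_commute)
  ultimately show ?thesis unfolding e_def[symmetric] by linarith
qed

lemma residual_lipschitz:
  fixes T :: "'a::real_normed_vector \<Rightarrow> 'a"
  assumes "L-lipschitz_on C T" "x \<in> C" "y \<in> C"
  shows "norm ((x - T x) - (y - T y)) \<le> (1 + L) * norm (x - y)"
proof -
  have "norm (T x - T y) \<le> L * norm (x - y)"
    using lipschitz_onD[OF assms] by (simp add: dist_norm)
  moreover have "norm ((x - T x) - (y - T y)) \<le> norm (x - y) + norm (T x - T y)"
    using norm_triangle_ineq4[of "x - y" "T x - T y"] by (simp add: algebra_simps)
  ultimately show ?thesis by (simp add: algebra_simps)
qed

text \<open>The operator \<open>B z = z - T z + s (z - c)\<close> is Lipschitz and strongly monotone with modulus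
  \<open>s\<close>, so \<open>z \<mapsto> z - l B z\<close> is a strict contraction for small \<open>l > 0\<close>. For small \<open>l\<close> this map also
  sends \<open>z\<close> to a convex combination of \<open>z\<close>, \<open>T z\<close> and \<open>c\<close>, hence it preserves \<open>C\<close>.\<close>

lemma regularized_zero_exists:
  fixes C :: "'a::{real_inner, complete_space} set"
  assumes "closed C" "convex C" "T ` C \<subseteq> C" "pseudo_contraction_on C T" "L-lipschitz_on C T"
    and "c \<in> C" "0 < s"
  shows "\<exists>z\<in>C. z - T z = s *\<^sub>R (c - z)"
proof -
  define B where "B z = (z - T z) + s *\<^sub>R (z - c)" for z
  define M where "M = 1 + L + s"
  \<comment> \<open>\<open>M\<close> is a Lipschitz constant of \<open>B\<close>, and this \<open>l\<close> minimizes the squared contraction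
    factor \<open>1 - 2 l s + l\<^sup>2 M\<^sup>2\<close> of \<open>g\<close>.\<close>
  define l where "l = s / M\<^sup>2"
  define g where "g z = z - l *\<^sub>R B z" for z
  have L0: "0 \<le> L" using assms(5) by (rule lipschitz_on_nonneg)
  have M: "0 < M" "s < M" "1 + s \<le> M" using L0 \<open>0 < s\<close> by (auto simp: M_def)
  have l0: "0 < l" using M \<open>0 < s\<close> by (simp add: l_def)
  have "s * (1 + s) \<le> M * M" using M \<open>0 < s\<close> by (intro mult_mono) auto
  then have l1: "l * (1 + s) \<le> 1" using M by (simp add: l_def power2_eq_square)
  have gC: "g z \<in> C" if z: "z \<in> C" for z
  proof -
    have Tz: "T z \<in> C" using assms(3) z by blast
    define w where "w = (1 / (1 + s)) *\<^sub>R T z + (s / (1 + s)) *\<^sub>R c"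
    have "w \<in> C" unfolding w_def using \<open>0 < s\<close> Tz \<open>c \<in> C\<close>
      by (intro convexD[OF assms(2)]) (auto simp: field_simps)
    have "(1 + s) *\<^sub>R w = T z + s *\<^sub>R c" using \<open>0 < s\<close> by (simp add: w_def scaleR_add_right)
    then have "(1 - l * (1 + s)) *\<^sub>R z + (l * (1 + s)) *\<^sub>R w
        = (1 - l * (1 + s)) *\<^sub>R z + l *\<^sub>R (T z + s *\<^sub>R c)" by (metis scaleR_scaleR)
    also have "\<dots> = g z" by (simp add: g_def B_def algebra_simps)
    finally have "g z = (1 - l * (1 + s)) *\<^sub>R z + (l * (1 + s)) *\<^sub>R w" by simp
    moreover have "(1 - l * (1 + s)) *\<^sub>R z + (l * (1 + s)) *\<^sub>R w \<in> C"
      using z \<open>w \<in> C\<close> l0 l1 \<open>0 < s\<close> by (intro convexD[OF assms(2)]) auto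
    ultimately show ?thesis by simp
  qed
  define k where "k = sqrt (1 - s\<^sup>2 / M\<^sup>2)"
  have "s\<^sup>2 < M\<^sup>2" using M \<open>0 < s\<close> by (intro power_strict_mono) auto
  then have k2: "0 < 1 - s\<^sup>2 / M\<^sup>2" "1 - s\<^sup>2 / M\<^sup>2 < 1" using M \<open>0 < s\<close> by (auto simp: field_simps)
  have con: "dist (g z) (g w) \<le> k * dist z w" if z: "z \<in> C" and w: "w \<in> C" for z w
  proof -
    have Bd: "B z - B w = ((z - T z) - (w - T w)) + s *\<^sub>R (z - w)"
      by (simp add: B_def algebra_simps)
    have "norm (B z - B w) \<le> norm ((z - T z) - (w - T w)) + s * norm (z - w)"
      unfolding Bd using \<open>0 < s\<close> by (intro norm_triangle_le) simp
    then have "norm (B z - B w) \<le> M * norm (z - w)"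
      using residual_lipschitz[OF assms(5) z w] by (simp add: M_def algebra_simps)
    then have lip: "(norm (B z - B w))\<^sup>2 \<le> M\<^sup>2 * (norm (z - w))\<^sup>2"
      by (metis norm_ge_zero power_mono power_mult_distrib)
    have "(B z - B w) \<bullet> (z - w) = ((z - T z) - (w - T w)) \<bullet> (z - w) + s * (norm (z - w))\<^sup>2"
      unfolding Bd by (simp only: inner_add_left inner_scaleR_left power2_norm_eq_inner)
    then have mon: "s * (norm (z - w))\<^sup>2 \<le> (B z - B w) \<bullet> (z - w)"
      using pseudo_contraction_monotone[OF assms(4) z w] by linarith
    have "g z - g w = (z - w) - l *\<^sub>R (B z - B w)" by (simp add: g_def algebra_simps)
    then have "(norm (g z - g w))\<^sup>2
        = (norm (z - w))\<^sup>2 - 2 * l * ((B z - B w) \<bullet> (z - w)) + l\<^sup>2 * (norm (B z - B w))\<^sup>2"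
      unfolding power2_norm_eq_inner
      by (simp only: inner_diff_left[of "z - w"] inner_diff_right[of _ "z - w"])
         (simp add: inner_commute power2_eq_square algebra_simps)
    also have "\<dots> \<le> (norm (z - w))\<^sup>2 - 2 * l * (s * (norm (z - w))\<^sup>2)
                     + l\<^sup>2 * (M\<^sup>2 * (norm (z - w))\<^sup>2)"
      using mon lip l0 by (intro add_mono diff_mono mult_left_mono) auto
    also have "\<dots> = (1 - s\<^sup>2 / M\<^sup>2) * (norm (z - w))\<^sup>2"
      using M by (simp add: l_def field_simps power2_eq_square)
    also have "\<dots> = (k * norm (z - w))\<^sup>2" using k2 by (simp add: k_def power_mult_distrib)
    finally show ?thesis
      using k2 by (simp add: dist_norm) (rule power2_le_imp_le, auto simp: k_def)
  qed
  have "\<exists>!z\<in>C. g z = z"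
    by (rule Banach_fix[where c = k])
       (use assms(1) \<open>c \<in> C\<close> k2 gC con in \<open>auto simp: complete_eq_closed k_def\<close>)
  then obtain z where "z \<in> C" "g z = z" by blast
  moreover from this have "B z = 0" using l0 by (simp add: g_def)
  then have "z - T z = s *\<^sub>R (c - z)" by (simp add: B_def algebra_simps add_eq_0_iff)
  ultimately show ?thesis by blast
qed

text \<open>Monotonicity of \<open>I - T\<close> between two points of the path makes the one with the larger
  parameter the vertex of an obtuse angle, so distances to \<open>c\<close> grow as the parameter shrinks
  and the path is Cauchy. Between a point of the path and a fixed point it gives
  the variational inequality that identifies the limit as a projection. In particular the
  projection onto the fixed points is attained.\<close>

lemma regularized_path_converges:
  fixes C :: "'a::{real_inner, complete_space} set"
  assumes "closed C" "convex C" "T ` C \<subseteq> C" "pseudo_contraction_on C T" "L-lipschitz_on C T"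
    and "c \<in> C" "fixed_points C T \<noteq> {}"
  obtains z :: "nat \<Rightarrow> 'a" where
    "\<And>k. z k \<in> C"
    "\<And>k. z k - T (z k) = inverse (real (Suc k)) *\<^sub>R (c - z k)"
    "z \<longlonglongrightarrow> metric_proj (fixed_points C T) c"
    "metric_proj (fixed_points C T) c \<in> fixed_points C T"
proof -
  define s where "s k = inverse (real (Suc k))" for k
  have s0: "0 < s k" for k by (simp add: s_def)
  have "\<forall>k. \<exists>z. z \<in> C \<and> z - T z = s k *\<^sub>R (c - z)"
    using regularized_zero_exists[OF assms(1-6) s0] by blast
  from choice[OF this] obtain z
    where zC: "\<And>k. z k \<in> C" and zA: "\<And>k. z k - T (z k) = s k *\<^sub>R (c - z k)"
    by blast
  have obtuse: "0 \<le> (z n - z m) \<bullet> (z m - c)" if "m \<le> n" for m n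
  proof (cases "s n = s m")
    case True
    then have "m = n" by (simp add: s_def)
    then show ?thesis by simp
  next
    case False
    moreover have "s n \<le> s m" unfolding s_def using that by (intro le_imp_inverse_le) auto
    ultimately have less: "s n < s m" by simp
    have "0 \<le> (s n *\<^sub>R (c - z n) - s m *\<^sub>R (c - z m)) \<bullet> (z n - z m)"
      using pseudo_contraction_monotone[OF assms(4) zC zC, of n m] by (simp only: zA)
    also have "s n *\<^sub>R (c - z n) - s m *\<^sub>R (c - z m)
        = (s m - s n) *\<^sub>R (z m - c) - s n *\<^sub>R (z n - z m)" by (simp add: algebra_simps)
    finally have "0 \<le> (s m - s n) * ((z m - c) \<bullet> (z n - z m)) - s n * ((z n - z m) \<bullet> (z n - z m))"
      by (simp only: inner_diff_left[of "_ *\<^sub>R _"] inner_scaleR_left)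
    moreover have "0 \<le> s n * ((z n - z m) \<bullet> (z n - z m))" using s0[of n] by simp
    ultimately have "0 \<le> (s m - s n) * ((z m - c) \<bullet> (z n - z m))" by linarith
    then show ?thesis using less by (simp add: zero_le_mult_iff inner_commute)
  qed
  have fix_var: "0 \<le> (p - z k) \<bullet> (z k - c)" if "p \<in> fixed_points C T" for p k
  proof -
    have p: "p \<in> C" "T p = p" using that by (auto simp: fixed_points_def)
    have "0 \<le> (s k *\<^sub>R (c - z k)) \<bullet> (z k - p)"
      using pseudo_contraction_monotone[OF assms(4) zC p(1), of k] p(2) by (simp only: zA) simp
    then have "0 \<le> (c - z k) \<bullet> (z k - p)" using s0[of k] by (simp add: zero_le_mult_iff)
    then show ?thesis by (simp add: algebra_simps inner_commute)
  qed
  obtain p where p: "p \<in> fixed_points C T" using assms(7) by blast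
  have bound: "norm (z k - c) \<le> norm (p - c)" for k
    by (rule obtuse_angle_norm_mono[OF fix_var[OF p]])
  have "Cauchy z"
    using obtuse bound by (rule obtuse_sequence_Cauchy)
  then obtain q where q: "z \<longlonglongrightarrow> q" by (metis Cauchy_convergent convergent_def)
  have qC: "q \<in> C" using assms(1) zC q by (meson closed_sequentially)
  have "(\<lambda>k. T (z k)) \<longlonglongrightarrow> T q"
    using lipschitz_on_continuous_on[OF assms(5)] q qC zC
    by (auto intro: continuous_on_tendsto_compose)
  then have "(\<lambda>k. z k - T (z k)) \<longlonglongrightarrow> q - T q" using q by (intro tendsto_diff)
  moreover have "(\<lambda>k. z k - T (z k)) \<longlonglongrightarrow> 0 *\<^sub>R (c - q)"
    unfolding zA s_def by (intro tendsto_intros q LIMSEQ_inverse_real_of_nat)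
  ultimately have "q - T q = 0 *\<^sub>R (c - q)" by (rule LIMSEQ_unique)
  then have qF: "q \<in> fixed_points C T" using qC by (simp add: fixed_points_def)
  have "0 \<le> (w - q) \<bullet> (q - c)" if "w \<in> fixed_points C T" for w
  proof (rule LIMSEQ_le_const)
    show "(\<lambda>k. (w - z k) \<bullet> (z k - c)) \<longlonglongrightarrow> (w - q) \<bullet> (q - c)" by (intro tendsto_intros q)
  qed (use fix_var[OF that] in auto)
  then have "metric_proj (fixed_points C T) c = q" by (rule metric_proj_eqI[OF qF])
  then show ?thesis using that[of z] zC zA q qF by (simp add: s_def)
qed

section \<open>Strong convergence of approximate fixed points\<close>

text \<open>This replaces the combination of weak compactness, demiclosedness and the Kadec-Klee
  property. Let \<open>q\<close> be the projection of \<open>c\<close> onto the fixed points. For each point \<open>z\<close> of the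
  regularized path, \<open>norm (x n - z)\<^sup>2\<close> exceeds \<open>norm (q - c)\<^sup>2 - norm (z - c)\<^sup>2\<close> by at most a
  multiple, with a factor independent of \<open>n\<close>, of the norm of \<open>x n - T (x n)\<close>. Choosing first
  \<open>z\<close> near \<open>q\<close> and then \<open>n\<close> large makes \<open>x n\<close> close to \<open>z\<close>, hence to \<open>q\<close>.\<close>

lemma converges_to_nearest_fixed_point:
  fixes C :: "'a::{real_inner, complete_space} set" and x :: "nat \<Rightarrow> 'a"
  assumes "closed C" "convex C" "T ` C \<subseteq> C" "pseudo_contraction_on C T" "L-lipschitz_on C T"
    and "c \<in> C" "fixed_points C T \<noteq> {}"
    and xC: "\<And>n. x n \<in> C"
    and near: "\<And>n. norm (x n - c) \<le> norm (metric_proj (fixed_points C T) c - c)"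
    and residual: "(\<lambda>n. x n - T (x n)) \<longlonglongrightarrow> 0"
  shows "x \<longlonglongrightarrow> metric_proj (fixed_points C T) c"
proof -
  define q where "q = metric_proj (fixed_points C T) c"
  obtain z where zC: "\<And>k. z k \<in> C"
    and zA: "\<And>k. z k - T (z k) = inverse (real (Suc k)) *\<^sub>R (c - z k)"
    and zq: "z \<longlonglongrightarrow> q" and "q \<in> fixed_points C T"
    by (rule regularized_path_converges[OF assms(1-7), folded q_def]) (rule that)
  have main: "(norm (x n - z k))\<^sup>2 \<le> ((norm (q - c))\<^sup>2 - (norm (z k - c))\<^sup>2)
      + 2 * real (Suc k) * ((norm (q - c) + norm (z k - c)) * norm (x n - T (x n)))" for n k
  proof -
    have "0 \<le> ((x n - T (x n)) - inverse (real (Suc k)) *\<^sub>R (c - z k)) \<bullet> (x n - z k)"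
      using pseudo_contraction_monotone[OF assms(4) xC zC, of n k] by (simp only: zA)
    then have "inverse (real (Suc k)) * ((c - z k) \<bullet> (x n - z k)) \<le> (x n - T (x n)) \<bullet> (x n - z k)"
      by (simp only: inner_diff_left[of "_ - _"] inner_scaleR_left)
    also have "\<dots> \<le> norm (x n - T (x n)) * norm (x n - z k)" by (rule norm_cauchy_schwarz)
    also have "\<dots> \<le> norm (x n - T (x n)) * (norm (q - c) + norm (z k - c))"
      using norm_triangle_ineq4[of "x n - c" "z k - c"] near[of n]
      by (intro mult_left_mono) (auto simp: q_def)
    finally have "(c - z k) \<bullet> (x n - z k)
        \<le> real (Suc k) * ((norm (q - c) + norm (z k - c)) * norm (x n - T (x n)))"
      by (simp add: field_simps)
    moreover have "(norm (x n - z k))\<^sup>2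
        = (norm (x n - c))\<^sup>2 - (norm (z k - c))\<^sup>2 + 2 * ((c - z k) \<bullet> (x n - z k))"
      by (simp add: power2_norm_eq_inner algebra_simps inner_commute)
    moreover have "(norm (x n - c))\<^sup>2 \<le> (norm (q - c))\<^sup>2"
      using near[of n] by (simp add: q_def power_mono)
    ultimately show ?thesis by linarith
  qed
  show ?thesis
    unfolding q_def[symmetric]
  proof (rule metric_LIMSEQ_I)
    fix e :: real assume e: "0 < e"
    have "(\<lambda>k. (norm (q - c))\<^sup>2 - (norm (z k - c))\<^sup>2) \<longlonglongrightarrow> (norm (q - c))\<^sup>2 - (norm (q - c))\<^sup>2"
      by (intro tendsto_intros zq)
    then have "\<forall>\<^sub>F k in sequentially. (norm (q - c))\<^sup>2 - (norm (z k - c))\<^sup>2 < (e/2)\<^sup>2 / 2"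
      by (rule order_tendstoD(2)) (use e in simp)
    moreover have "\<forall>\<^sub>F k in sequentially. dist (z k) q < e/2"
      using zq e by (intro tendstoD) auto
    ultimately have "\<forall>\<^sub>F k in sequentially.
        (norm (q - c))\<^sup>2 - (norm (z k - c))\<^sup>2 < (e/2)\<^sup>2 / 2 \<and> dist (z k) q < e/2"
      by (rule eventually_conj)
    then obtain k where k: "(norm (q - c))\<^sup>2 - (norm (z k - c))\<^sup>2 < (e/2)\<^sup>2 / 2"
      "dist (z k) q < e/2"
      using eventually_happens'[OF sequentially_bot] by blast
    have "(\<lambda>n. 2 * real (Suc k) * ((norm (q - c) + norm (z k - c)) * norm (x n - T (x n)))) \<longlonglongrightarrow>
        2 * real (Suc k) * ((norm (q - c) + norm (z k - c)) * norm (0::'a))"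
      by (intro tendsto_intros residual)
    then have "\<forall>\<^sub>F n in sequentially.
        2 * real (Suc k) * ((norm (q - c) + norm (z k - c)) * norm (x n - T (x n))) < (e/2)\<^sup>2 / 2"
      by (rule order_tendstoD(2)) (use e in simp)
    then obtain N where N: "\<And>n. N \<le> n \<Longrightarrow>
        2 * real (Suc k) * ((norm (q - c) + norm (z k - c)) * norm (x n - T (x n))) < (e/2)\<^sup>2 / 2"
      unfolding eventually_sequentially by blast
    have "dist (x n) q < e" if "N \<le> n" for n
    proof -
      have "(norm (x n - z k))\<^sup>2 < (e/2)\<^sup>2" using main[of n k] k(1) N[OF that] by linarith
      then have "dist (x n) (z k) < e/2" unfolding dist_norm
        using e by (intro power2_less_imp_less[where y = "e/2"]) auto
      then show ?thesis using k(2) dist_triangle[of "x n" q "z k"] by linarith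
    qed
    then show "\<exists>N. \<forall>n\<ge>N. dist (x n) q < e" by blast
  qed
qed

section \<open>The hybrid iteration\<close>

theorem theorem6p2:
  fixes C :: "'a::{real_inner, complete_space} set"
    and T :: "'a \<Rightarrow> 'a"
    and L a b \<tau>\<^sub>0 :: real
    and \<tau> \<alpha> \<beta> :: "nat \<Rightarrow> real"
    and x v y :: "nat \<Rightarrow> 'a"
    and C' C'' Cn Cstar Q :: "nat \<Rightarrow> 'a set"
  assumes "C \<noteq> {}" and "closed C" and "convex C"
    and "T ` C \<subseteq> C"
    and "pseudo_contraction_on C T"
    and "L \<ge> 1" and "L-lipschitz_on C T"
    and "fixed_points C T \<noteq> {}"
    and "\<tau>\<^sub>0 \<in> {0<..1}" and "\<And>n. \<tau> n \<in> {\<tau>\<^sub>0..1}"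
    and "a \<in> {0<..<1 / (L + 1)}" and "b \<in> {0<..<1 / (L + 1)}"
    and "\<And>n. \<alpha> n \<in> {a..b}"
    and "\<And>n. \<beta> n \<in> {0<..<1}" and "\<And>n. \<beta> n \<le> \<alpha> n"
    and "x 0 \<in> C"
    and "\<And>n. v n = (1 - \<alpha> n) *\<^sub>R x n + \<alpha> n *\<^sub>R T (x n)"
    and "\<And>n. y n = (1 - \<beta> n) *\<^sub>R x n + \<beta> n *\<^sub>R T (v n)"
    and "\<And>n. C' n = {z \<in> C. \<tau> n * \<alpha> n * (1 - (1 + L) * \<alpha> n) * (norm (x n - T (x n)))\<^sup>2
                       \<le> (x n - z) \<bullet> (v n - T (v n))}"
    and "\<And>n. C'' n = {z \<in> C. (norm (y n - z))\<^sup>2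
                       \<le> (norm (x n - z))\<^sup>2
                          - \<alpha> n * \<beta> n * (1 - 2 * \<alpha> n - L\<^sup>2 * (\<alpha> n)\<^sup>2) * (norm (x n - T (x n)))\<^sup>2}"
    and "\<And>n. Cn n = C' n \<inter> C'' n"
    and "\<And>n. Q n = {z \<in> C. (z - x n) \<bullet> (x n - x 0) \<ge> 0}"
    and "\<And>n. closed (Cstar n)" and "\<And>n. convex (Cstar n)"
    and "\<And>n. fixed_points C T \<subseteq> Cstar n" and "\<And>n. Cstar n \<subseteq> Cn n"
    and "\<And>n. x (Suc n) = metric_proj (Cstar n \<inter> Q n) (x 0)"
  shows "x \<longlonglongrightarrow> metric_proj (fixed_points C T) (x 0)"
proof -
  note C = \<open>closed C\<close> \<open>convex C\<close> \<open>T ` C \<subseteq> C\<close> \<open>pseudo_contraction_on C T\<close> \<open>L-lipschitz_on C T\<close>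
  note v_eq = assms(17) and C'_eq = assms(19) and Cn_eq = assms(21) and Q_set = assms(22)
    and F_Cstar = assms(25) and Cstar_Cn = assms(26) and x_Suc = assms(27)
  define F where "F = fixed_points C T"
  define D where "D n = Cstar n \<inter> Q n" for n
  define q where "q = metric_proj F (x 0)"
  have F_C: "F \<subseteq> C" by (auto simp: F_def fixed_points_def)
  have qF: "q \<in> F"
    using regularized_path_converges[OF C \<open>x 0 \<in> C\<close> \<open>fixed_points C T \<noteq> {}\<close>]
    unfolding q_def F_def by metis
  have Q_eq: "Q n = C \<inter> {z. (x n - x 0) \<bullet> x n \<le> (x n - x 0) \<bullet> z}" for n
    unfolding Q_set by (auto simp: inner_diff_left inner_diff_right inner_commute)
  have "closed (Q n)" "convex (Q n)" for n
    unfolding Q_eq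
    using \<open>closed C\<close> \<open>convex C\<close> closed_halfspace_ge convex_halfspace_ge
    by (auto intro!: closed_Int convex_Int)
  then have D: "closed (D n)" "convex (D n)" for n
    using assms(23,24) by (auto simp: D_def intro!: closed_Int convex_Int)
  have F_Q: "F \<subseteq> Q n" for n
  proof (induction n)
    case 0
    show ?case using F_C by (auto simp: Q_set)
  next
    case (Suc n)
    then have F_D: "F \<subseteq> D n" using F_Cstar by (auto simp: D_def F_def)
    then have "D n \<noteq> {}" using qF by blast
    from metric_proj_variational(2)[OF D this, of _ "x 0"] F_D
    have "0 \<le> (z - x (Suc n)) \<bullet> (x (Suc n) - x 0)" if "z \<in> F" for z
      using that x_Suc[of n] by (auto simp: D_def)
    then show ?case using F_C by (auto simp: Q_set)
  qed
  have xSuc_D: "x (Suc n) \<in> D n" for n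
  proof -
    have "q \<in> D n" using qF F_Q F_Cstar by (auto simp: D_def F_def)
    then show ?thesis using metric_proj_variational(1)[OF D, of n "x 0"] x_Suc[of n]
      by (auto simp: D_def)
  qed
  have xC: "x n \<in> C" for n
    using xSuc_D \<open>x 0 \<in> C\<close> by (cases n) (auto simp: D_def Q_set)
  have near: "norm (x n - x 0) \<le> norm (q - x 0)" for n
  proof -
    have "0 \<le> (q - x n) \<bullet> (x n - x 0)" using F_Q[of n] qF by (auto simp: Q_set)
    then show ?thesis by (rule obtuse_angle_norm_mono)
  qed
  have steps: "(\<lambda>n. norm (x (Suc n) - x n)) \<longlonglongrightarrow> 0"
  proof (rule obtuse_steps_tendsto_0[OF _ near])
    fix n show "0 \<le> (x (Suc n) - x n) \<bullet> (x n - x 0)"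
      using xSuc_D[of n] by (auto simp: D_def Q_set)
  qed
  \<comment> \<open>\<open>R\<close> bounds the distance of every iterate from \<open>q\<close>, by the triangle inequality through \<open>x 0\<close>;
    \<open>\<kappa>\<close> is a positive lower bound, uniform in \<open>n\<close>, of the coefficient in \<open>C' n\<close>.\<close>
  define R where "R = 2 * norm (q - x 0)"
  define \<kappa> where "\<kappa> = \<tau>\<^sub>0 * a * (1 - (1 + L) * b)"
  have b: "0 < 1 - (1 + L) * b" and b1: "b < 1"
  proof -
    show "0 < 1 - (1 + L) * b" using \<open>b \<in> _\<close> \<open>L \<ge> 1\<close> by (auto simp: field_simps)
    have "1 / (L + 1) \<le> 1" using \<open>L \<ge> 1\<close> by simp
    then show "b < 1" using \<open>b \<in> _\<close> by auto
  qed
  have \<kappa>: "0 < \<kappa>" using b \<open>\<tau>\<^sub>0 \<in> _\<close> \<open>a \<in> _\<close> by (auto simp: \<kappa>_def)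
  have residual_bound:
    "\<kappa> * (norm (x n - T (x n)))\<^sup>2 \<le> (1 + L) * ((1 + L) * R) * norm (x (Suc n) - x n)" for n
  proof -
    have \<alpha>: "0 < \<alpha> n" "\<alpha> n \<le> 1" "a \<le> \<alpha> n" "\<alpha> n \<le> b"
      using assms(13)[of n] \<open>a \<in> _\<close> b1 by auto
    have TxC: "T (x n) \<in> C" using xC \<open>T ` C \<subseteq> C\<close> by blast
    have vC: "v n \<in> C"
      unfolding v_eq using \<alpha> xC TxC by (intro convexD[OF \<open>convex C\<close>]) auto
    have qC: "q \<in> C" "T q = q" using qF by (auto simp: F_def fixed_points_def)
    have xq: "norm (x n - q) \<le> R"
      using norm_triangle_ineq4[of "x n - x 0" "q - x 0"] near[of n] by (simp add: R_def)
    have Txq: "norm (T (x n) - q) \<le> L * norm (x n - q)"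
      using lipschitz_onD[OF \<open>L-lipschitz_on C T\<close> xC[of n] qC(1)] qC(2) by (simp add: dist_norm)
    have "v n - q = (1 - \<alpha> n) *\<^sub>R (x n - q) + \<alpha> n *\<^sub>R (T (x n) - q)"
      unfolding v_eq by (simp add: algebra_simps)
    then have "norm (v n - q) \<le> (1 - \<alpha> n) * norm (x n - q) + \<alpha> n * norm (T (x n) - q)"
      using norm_triangle_ineq[of "(1 - \<alpha> n) *\<^sub>R (x n - q)" "\<alpha> n *\<^sub>R (T (x n) - q)"] \<alpha> by simp
    also have "\<dots> \<le> 1 * norm (x n - q) + 1 * (L * norm (x n - q))"
      using \<alpha> Txq by (intro add_mono mult_mono) auto
    also have "\<dots> = (1 + L) * norm (x n - q)" by (simp add: algebra_simps)
    also have "\<dots> \<le> (1 + L) * R" using xq \<open>L \<ge> 1\<close> by (intro mult_left_mono) auto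
    finally have vq: "norm (v n - q) \<le> (1 + L) * R" .
    have vres: "norm (v n - T (v n)) \<le> (1 + L) * ((1 + L) * R)"
    proof -
      have "norm (v n - T (v n)) \<le> (1 + L) * norm (v n - q)"
        using residual_lipschitz[OF \<open>L-lipschitz_on C T\<close> vC qC(1)] qC(2) by simp
      also have "\<dots> \<le> (1 + L) * ((1 + L) * R)" using vq \<open>L \<ge> 1\<close> by (intro mult_left_mono) auto
      finally show ?thesis .
    qed
    have \<tau>: "0 < \<tau>\<^sub>0" "\<tau>\<^sub>0 \<le> \<tau> n" using assms(9) assms(10)[of n] by auto
    have a: "0 < a" using assms(11) by simp
    have "1 - (1 + L) * b \<le> 1 - (1 + L) * \<alpha> n" using \<alpha>(4) \<open>L \<ge> 1\<close> by simp
    moreover have "\<tau>\<^sub>0 * a \<le> \<tau> n * \<alpha> n" using \<tau> a \<alpha> by (simp add: mult_mono)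
    moreover have "0 \<le> \<tau> n * \<alpha> n" using \<tau> \<alpha>(1) by simp
    ultimately have "\<kappa> \<le> \<tau> n * \<alpha> n * (1 - (1 + L) * \<alpha> n)"
      unfolding \<kappa>_def using b by (simp only: mult_mono less_imp_le)
    then have "\<kappa> * (norm (x n - T (x n)))\<^sup>2
        \<le> \<tau> n * \<alpha> n * (1 - (1 + L) * \<alpha> n) * (norm (x n - T (x n)))\<^sup>2"
      by (intro mult_right_mono) auto
    also have "\<dots> \<le> (x n - x (Suc n)) \<bullet> (v n - T (v n))"
      using xSuc_D[of n] Cstar_Cn[of n] unfolding D_def Cn_eq C'_eq by auto
    also have "\<dots> \<le> norm (x n - x (Suc n)) * norm (v n - T (v n))" by (rule norm_cauchy_schwarz)
    also have "\<dots> \<le> norm (x n - x (Suc n)) * ((1 + L) * ((1 + L) * R))"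
      using vres by (intro mult_left_mono) auto
    finally show ?thesis by (simp add: norm_minus_commute mult.commute)
  qed
  have "(\<lambda>n. (norm (x n - T (x n)))\<^sup>2) \<longlonglongrightarrow> 0"
  proof (rule tendsto_sandwich[OF _ _ tendsto_const])
    have "(\<lambda>n. (1 + L) * ((1 + L) * R) * norm (x (Suc n) - x n) / \<kappa>)
        \<longlonglongrightarrow> (1 + L) * ((1 + L) * R) * 0 / \<kappa>"
      using \<kappa> by (intro tendsto_intros steps) auto
    then show "(\<lambda>n. (1 + L) * ((1 + L) * R) * norm (x (Suc n) - x n) / \<kappa>) \<longlonglongrightarrow> 0" by simp
    show "\<forall>\<^sub>F n in sequentially. (norm (x n - T (x n)))\<^sup>2
        \<le> (1 + L) * ((1 + L) * R) * norm (x (Suc n) - x n) / \<kappa>"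
      by (intro always_eventually allI)
         (use residual_bound \<kappa> in \<open>simp add: pos_le_divide_eq mult.commute\<close>)
  qed simp
  then have "(\<lambda>n. sqrt ((norm (x n - T (x n)))\<^sup>2)) \<longlonglongrightarrow> sqrt 0" by (rule tendsto_real_sqrt)
  then have residual: "(\<lambda>n. x n - T (x n)) \<longlonglongrightarrow> 0" by (simp add: tendsto_norm_zero_iff)
  show ?thesis
  proof (rule converges_to_nearest_fixed_point[OF C \<open>x 0 \<in> C\<close> \<open>fixed_points C T \<noteq> {}\<close>])
    show "norm (x n - x 0) \<le> norm (metric_proj (fixed_points C T) (x 0) - x 0)" for n
      using near unfolding q_def F_def .
  qed (rule xC residual)+
qed

end
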